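(* Let $\kappa$ be an infinite cardinal and let $\mathcal{L}_\kappa$ denote the class of all regular spaces $X$ that are $\kappa^+$-compact and satisfy $|X| = \Delta(X) = \kappa^+$. If every member of $\mathcal{L}_\kappa$ is $\kappa$-resolvable, then every member of $\mathcal{L}_\kappa$ is $\kappa^+$-resolvable.
   Context: Regular spaces are understood to be $T_1$ (so regular implies Hausdorff). For a cardinal $\lambda$, a topological space $X$ is $\lambda$-resolvable if it contains $\lambda$ many pairwise disjoint dense subsets. The dispersion character of $X$ is $\Delta(X)=\min\{|G| : G \text{ is a non-empty open subset of } X\}$. A point $x\in X$ is a complete accumulation point of an infinite set $A\subset X$ if $|U\cap A|=|A|$ for every neighbourhood $U$ of $x$. A space $X$ is $\lambda$-compact if every subset of $X$ of cardinality $\lambda$ has a complete accumulation point in $X$. *)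

theory Defs
  imports "HOL-Analysis.Analysis"
begin

unbundle cardinal_syntax

text \<open>
  Cardinals are represented by cardinal orders (\<^const>\<open>Card_order\<close>), compared up to order isomorphism
  \<open>=o\<close>; the successor cardinal of \<open>\<kappa>\<close> is \<^term>\<open>cardSuc \<kappa>\<close>. A cardinal may live on a different
  type than the points of the space.
\<close>

definition dense_subset :: "'a topology \<Rightarrow> 'a set \<Rightarrow> bool" where
  "dense_subset X D \<longleftrightarrow> D \<subseteq> topspace X \<and> X closure_of D = topspace X"

definition resolvable :: "'k rel \<Rightarrow> 'a topology \<Rightarrow> bool" where
  "resolvable \<mu> X \<longleftrightarrow>
     (\<exists>\<D>. |\<D>| =o \<mu> \<and> pairwise disjnt \<D> \<and> (\<forall>D\<in>\<D>. dense_subset X D))"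

text \<open>The minimum in the next definition exists, and is unique up to \<open>=o\<close>, for every nonempty
  space; for the empty space the value is unspecified.\<close>

definition dispersion_character :: "'a topology \<Rightarrow> 'a rel" where
  "dispersion_character X =
     (SOME \<delta>. \<delta> \<in> card_of ` {G. openin X G \<and> G \<noteq> {}} \<and>
              (\<forall>G. openin X G \<and> G \<noteq> {} \<longrightarrow> \<delta> \<le>o |G| ))"

lemma dispersion_character_minimum:
  assumes "topspace X \<noteq> {}"
  shows "dispersion_character X \<in> card_of ` {G. openin X G \<and> G \<noteq> {}}"
    and "\<And>G. openin X G \<Longrightarrow> G \<noteq> {} \<Longrightarrow> dispersion_character X \<le>o |G|"
proof -
  let ?R = "card_of ` {G. openin X G \<and> G \<noteq> {}}"
  have "\<exists>\<delta>\<in>?R. \<forall>r\<in>?R. \<delta> \<le>o r"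
    by (rule exists_minim_Card_order) (use assms in \<open>auto simp: card_of_Card_order\<close>)
  then have "\<exists>\<delta>. \<delta> \<in> ?R \<and> (\<forall>G. openin X G \<and> G \<noteq> {} \<longrightarrow> \<delta> \<le>o |G| )"
    by blast
  from someI_ex[OF this]
  show "dispersion_character X \<in> ?R"
    and "\<And>G. openin X G \<Longrightarrow> G \<noteq> {} \<Longrightarrow> dispersion_character X \<le>o |G|"
    unfolding dispersion_character_def by blast+
qed

definition complete_accumulation_point :: "'a topology \<Rightarrow> 'a set \<Rightarrow> 'a \<Rightarrow> bool" where
  "complete_accumulation_point X A x \<longleftrightarrow>
     infinite A \<and> A \<subseteq> topspace X \<and> x \<in> topspace X \<and>
     (\<forall>U. openin X U \<and> x \<in> U \<longrightarrow> |U \<inter> A| =o |A| )"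

definition cardinal_compact :: "'k rel \<Rightarrow> 'a topology \<Rightarrow> bool" where
  "cardinal_compact \<mu> X \<longleftrightarrow>
     (\<forall>A. A \<subseteq> topspace X \<and> |A| =o \<mu> \<longrightarrow> (\<exists>x. complete_accumulation_point X A x))"

text \<open>The library's \<^const>\<open>regular_space\<close> does not include \<open>T\<^sub>1\<close>. Every space of size
  \<open>\<kappa>\<^sup>+\<close> is homeomorphic to one on any type with at least \<open>\<kappa>\<^sup>+\<close> elements, so on such
  a type the following set represents the whole class up to homeomorphism; on a smaller type it is empty.\<close>

definition class_L :: "'k rel \<Rightarrow> 'a topology set" where
  "class_L \<kappa> =
     {X. regular_space X \<and> t1_space X \<and> cardinal_compact (cardSuc \<kappa>) X \<and>
         |topspace X| =o dispersion_character X \<and> dispersion_character X =o cardSuc \<kappa>}"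

end

theory Submission
  imports Defs
begin

text \<open>
  Let \<open>\<lambda> = \<kappa>\<^sup>+\<close>, call sets of size at most \<open>\<kappa>\<close> small, and let \<open>acc B\<close> be the set
  of points all of whose neighbourhoods meet \<open>B\<close> in a set that is not small. Split a set
  \<open>A\<close> of size \<open>\<lambda>\<close> into \<open>\<lambda>\<close> columns of size \<open>\<lambda>\<close> and call a subset thin if it meets each
  column in a small set. Modulo small sets, any \<open>\<lambda>\<close> many thin sets have a thin upper bound.
  As there are only \<open>\<lambda>\<close> points, the set \<open>U W\<close> of points in some \<open>acc (W' - W)\<close>, for \<open>W'\<close> thin,
  equals a single \<open>acc (W' - W)\<close>, and it stops shrinking once \<open>W\<close> contains a suitable thin
  set \<open>M\<close>. This yields \<open>\<lambda>\<close> disjoint thin sets with the same set \<open>U M\<close> of accumulation points,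
  and a subset \<open>S\<close> of \<open>A\<close> that contains each of them up to a small set and satisfies
  \<open>acc S = U M\<close>.

  By regularity and compactness such sets \<open>S\<close> exist with \<open>acc S\<close> inside any given nonempty open
  set, so \<open>\<lambda>\<close> many of them have accumulation points that are dense together. Well-order these in
  type \<open>\<lambda>\<close>, remove from each \<open>S\<close> the earlier ones, and unite the pieces of equal index to obtain
  the dense sets. Indeed, if \<open>S\<close> is the first one with an accumulation point in an open set
  \<open>V\<close>, then the at most \<open>\<kappa>\<close> many earlier ones together meet a smaller neighbourhood of that
  point in a small set only.
\<close>

section \<open>Sets of size at most \<open>\<kappa>\<close>\<close>

locale infinite_cardinal =
  fixes \<kappa> :: "'k rel"
  assumes card_order: "Card_order \<kappa>" and infinite: "cinfinite \<kappa>"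
begin

definition small :: "'b set \<Rightarrow> bool" where
  "small A \<longleftrightarrow> |A| \<le>o \<kappa>"

lemma small_iff_less: "small A \<longleftrightarrow> |A| <o cardSuc \<kappa>"
  unfolding small_def using cardSuc_ordLeq_ordLess[OF card_order card_of_Card_order] by blast

lemma not_small_iff: "\<not> small A \<longleftrightarrow> cardSuc \<kappa> \<le>o |A|"
  unfolding small_iff_less
  by (rule not_ordLess_iff_ordLeq[OF cardSuc_Well_order[OF card_order] card_of_Well_order])

lemma small_mono: "small B \<Longrightarrow> A \<subseteq> B \<Longrightarrow> small A"
  unfolding small_def using card_of_mono1 ordLeq_transitive by blast

lemma small_UN: "small I \<Longrightarrow> (\<And>i. i \<in> I \<Longrightarrow> small (A i)) \<Longrightarrow> small (\<Union>i\<in>I. A i)"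
  unfolding small_def
  using card_of_UNION_ordLeq_infinite_Field[of \<kappa> I A] card_order infinite
  by (auto simp: cinfinite_def)

lemma small_finite: "finite A \<Longrightarrow> small A"
  unfolding small_def
  using card_order infinite
  by (metis cinfinite_def card_of_Well_order card_of_Field_ordIso finite_ordLess_infinite
      card_order_on_well_order_on Field_card_of ordLess_imp_ordLeq)

lemma small_empty [simp]: "small {}"
  by (simp add: small_finite)

lemma small_Un: "small A \<Longrightarrow> small B \<Longrightarrow> small (A \<union> B)"
  unfolding small_def
  using card_order infinite by (simp add: cinfinite_def card_of_Un_ordLeq_infinite_Field)

lemma small_image: "small A \<Longrightarrow> small (f ` A)"
  unfolding small_def using card_of_image ordLeq_transitive by blast

lemma card_eq_not_small: "|A| =o cardSuc \<kappa> \<Longrightarrow> \<not> small A"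
  unfolding not_small_iff by (simp add: ordIso_iff_ordLeq)

lemma card_eq_not_finite: "|A| =o cardSuc \<kappa> \<Longrightarrow> \<not> finite A"
  using card_eq_not_small small_finite by blast

lemma card_eqI: "\<not> small A \<Longrightarrow> A \<subseteq> B \<Longrightarrow> |B| =o cardSuc \<kappa> \<Longrightarrow> |A| =o cardSuc \<kappa>"
  unfolding not_small_iff
  by (meson card_of_mono1 ordIso_iff_ordLeq ordLeq_ordIso_trans)

section \<open>Columns and thin sets\<close>

lemma small_underS:
  assumes "|A| =o cardSuc \<kappa>" "a \<in> A"
  shows "small (underS |A| a)"
  unfolding small_iff_less
  using card_of_underS[of "|A|" a] assms card_of_Card_order Field_card_of
  by (metis ordLess_ordIso_trans)

text \<open>Since \<open>I\<close> is infinite, \<open>A\<close> is in bijection with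
  \<open>I \<times> I\<close>. The first coordinate serves as colouring, and the second coordinate
  maps every fibre onto \<open>I\<close>.\<close>

lemma not_small_fibres:
  assumes A: "|A| =o cardSuc \<kappa>" and I: "|I| =o cardSuc \<kappa>"
  shows "\<exists>c. c ` A \<subseteq> I \<and> (\<forall>i\<in>I. \<not> small {a \<in> A. c a = i})"
proof -
  have "|A| =o |I|"
    using A I ordIso_symmetric ordIso_transitive by blast
  also have "|I| =o |I \<times> I|"
    using card_of_Times_same_infinite card_eq_not_finite[OF I] ordIso_symmetric by blast
  finally obtain f where f: "bij_betw f A (I \<times> I)"
    using card_of_ordIso by blast
  show ?thesis
  proof (intro exI[of _ "fst \<circ> f"] conjI ballI)
    show "(fst \<circ> f) ` A \<subseteq> I"
      using bij_betw_apply[OF f] by (auto simp: mem_Times_iff)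
    fix i assume i: "i \<in> I"
    have "I \<subseteq> (snd \<circ> f) ` {a \<in> A. (fst \<circ> f) a = i}"
    proof
      fix j assume "j \<in> I"
      then obtain a where "a \<in> A" "f a = (i, j)"
        using f i by (force simp: bij_betw_def)
      then show "j \<in> (snd \<circ> f) ` {a \<in> A. (fst \<circ> f) a = i}"
        by force
    qed
    then show "\<not> small {a \<in> A. (fst \<circ> f) a = i}"
      using card_eq_not_small[OF I] small_image small_mono by blast
  qed
qed

text \<open>The directedness of \<open>\<lambda>\<^sup>\<lambda>\<close> under eventual domination, for \<open>\<lambda> = \<kappa>\<^sup>+\<close>.\<close>

lemma thin_upper_bound:
  assumes I: "|I| =o cardSuc \<kappa>" and c: "c ` A \<subseteq> I"
    and WA: "\<And>p. p \<in> I \<Longrightarrow> W p \<subseteq> A"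
    and thin: "\<And>p i. p \<in> I \<Longrightarrow> i \<in> I \<Longrightarrow> small {a \<in> W p. c a = i}"
  shows "\<exists>B\<subseteq>A. (\<forall>i\<in>I. small {a \<in> B. c a = i}) \<and> (\<forall>p\<in>I. small (W p - B))"
proof (intro exI conjI ballI)
  \<comment> \<open>This is a diagonal along the well-order \<open>|I|\<close>: column
    \<open>i\<close> takes points only from the at most \<open>\<kappa>\<close> many
    \<open>W p\<close> with \<open>p\<close> before \<open>i\<close>, and \<open>W p\<close> can
    lose points only in its columns up to \<open>p\<close>.\<close>
  let ?B = "{a \<in> A. \<exists>p \<in> underS |I| (c a). a \<in> W p}"
  have uI: "underS |I| i \<subseteq> I" for i
    by (metis Field_card_of subsetI underS_Field)
  show "?B \<subseteq> A" by blast
  show "small {a \<in> ?B. c a = i}" if i: "i \<in> I" for i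
  proof (rule small_mono)
    show "small (\<Union>p \<in> underS |I| i. {a \<in> W p. c a = i})"
      using small_underS[OF I i] thin uI i by (intro small_UN) auto
  qed auto
  show "small (W p - ?B)" if p: "p \<in> I" for p
  proof (rule small_mono)
    show "small (\<Union>i \<in> insert p (underS |I| p). {a \<in> W p. c a = i})"
    proof (rule small_UN)
      show "small (insert p (underS |I| p))"
        using small_Un[OF small_finite[of "{p}"] small_underS[OF I p]] by simp
    qed (use thin p uI in auto)
    show "W p - ?B \<subseteq> (\<Union>i \<in> insert p (underS |I| p). {a \<in> W p. c a = i})"
    proof
      fix a assume a: "a \<in> W p - ?B"
      then have "a \<in> A" "c a \<in> I"
        using WA p c by auto
      moreover have "total_on I |I|"
        using card_of_well_order_on[of I] by (simp add: well_order_on_def linear_order_on_def)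
      ultimately show "a \<in> (\<Union>i \<in> insert p (underS |I| p). {a \<in> W p. c a = i})"
        using a p by (auto simp: underS_def total_on_def)
    qed
  qed
qed

section \<open>Disjoint sets with equal accumulation\<close>

text \<open>To be applied with \<open>\<phi> = acc X\<close> and the points of the space as
  \<open>I\<close>. The argument rests on \<open>\<phi>\<close> ignoring small sets and on its
  values having at most \<open>\<kappa>\<^sup>+\<close> elements, so that witnesses for all of these
  elements have one thin upper bound.\<close>

lemma equal_values_family:
  fixes \<phi> :: "'b set \<Rightarrow> 'c set"
  assumes A: "|A| =o cardSuc \<kappa>" and I: "|I| =o cardSuc \<kappa>"
    and sub: "\<And>B. \<phi> B \<subseteq> I" and mono: "\<And>B C. small (B - C) \<Longrightarrow> \<phi> B \<subseteq> \<phi> C"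
  shows "\<exists>S Y. S \<subseteq> A \<and> disjoint_family_on Y I \<and>
    (\<forall>i\<in>I. Y i \<subseteq> S \<and> \<not> small (Y i) \<and> \<phi> (Y i) = \<phi> S)"
proof -
  obtain c where c: "c ` A \<subseteq> I" "\<And>i. i \<in> I \<Longrightarrow> \<not> small {a \<in> A. c a = i}"
    using not_small_fibres[OF A I] by blast
  define thin where "thin W \<longleftrightarrow> W \<subseteq> A \<and> (\<forall>i\<in>I. small {a \<in> W. c a = i})" for W
  have thin_mono: "thin W" if "thin W'" "W \<subseteq> W'" for W W'
    proof -
    have "{a \<in> W. c a = i} \<subseteq> {a \<in> W'. c a = i}" for i
      using that(2) by blast
    then show ?thesis
      using that small_mono unfolding thin_def by (meson subset_trans)
  qed
  have thin_UN: "thin (\<Union>W\<in>\<W>. W)" if \<W>: "small \<W>" "\<And>W. W \<in> \<W> \<Longrightarrow> thin W" for \<W>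
  proof -
    have "small {a \<in> (\<Union>W\<in>\<W>. W). c a = i}" if "i \<in> I" for i
    proof (rule small_mono)
      show "small (\<Union>W\<in>\<W>. {a \<in> W. c a = i})"
        using \<W>(2) that unfolding thin_def by (intro small_UN[OF \<W>(1)]) blast
    qed auto
    then show ?thesis
      using \<W>(2) unfolding thin_def by blast
  qed
  have thin_Un: "thin (W \<union> W')" if "thin W" "thin W'" for W W'
  proof -
    have "thin (\<Union>W\<in>{W, W'}. W)"
      by (rule thin_UN[OF small_finite]) (use that in auto)
    then show ?thesis by simp
  qed
  have bound: "\<exists>B. thin B \<and> (\<forall>p\<in>I. small (W p - B))" if "\<And>p. p \<in> I \<Longrightarrow> thin (W p)" for W
  proof -
    have "\<exists>B\<subseteq>A. (\<forall>i\<in>I. small {a \<in> B. c a = i}) \<and> (\<forall>p\<in>I. small (W p - B))"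
      by (rule thin_upper_bound[OF I c(1)]) (use that in \<open>simp_all add: thin_def\<close>)
    then show ?thesis
      unfolding thin_def by blast
  qed
  \<comment> \<open>A thin set covers no column, so one point can be picked outside it in every
    column.\<close>
  have extend: "\<exists>N. thin N \<and> \<not> small N \<and> N \<inter> W = {}" if W: "thin W" for W
  proof -
    have "\<exists>a. a \<in> A \<and> c a = i \<and> a \<notin> W" if i: "i \<in> I" for i
    proof (rule ccontr)
      assume "\<nexists>a. a \<in> A \<and> c a = i \<and> a \<notin> W"
      then have "{a \<in> A. c a = i} \<subseteq> {a \<in> W. c a = i}" by blast
      then show False
        using W i c(2) small_mono unfolding thin_def by blast
    qed
    then obtain n where n: "\<And>i. i \<in> I \<Longrightarrow> n i \<in> A \<and> c (n i) = i \<and> n i \<notin> W" by metis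
    have "small {a \<in> n ` I. c a = i}" if "i \<in> I" for i
      by (rule small_mono[OF small_finite[of "{n i}"]]) (use n in auto)
    then have "thin (n ` I)"
      using n unfolding thin_def by blast
    moreover have "I \<subseteq> c ` n ` I"
      using n by force
    then have "\<not> small (n ` I)"
      using card_eq_not_small[OF I] small_image small_mono by blast
    ultimately show ?thesis
      using n by blast
  qed
  define U where "U W = (\<Union>W' \<in> Collect thin. \<phi> (W' - W))" for W
  have U_sub: "U W \<subseteq> I" for W
    using sub unfolding U_def by blast
  have U_antimono: "U W' \<subseteq> U W" if "small (W - W')" for W W'
    unfolding U_def
    by (intro UN_mono mono) (auto intro: small_mono[OF that])
  have U_attained: "\<exists>Y. thin Y \<and> Y \<inter> W = {} \<and> \<not> small Y \<and> \<phi> Y = U W" if W: "thin W" for W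
  proof -
    \<comment> \<open>For \<open>p\<close> outside \<open>U W\<close> any thin set will do, such as
      \<open>W\<close> itself. By \<open>mono\<close>, the upper bound \<open>B\<close> of the
      witnesses captures all of \<open>U W\<close> at once; \<open>N\<close> is added to keep
      \<open>?Y\<close> from being small.\<close>
    have "\<forall>p\<in>I. \<exists>W'. thin W' \<and> (p \<in> U W \<longrightarrow> p \<in> \<phi> (W' - W))"
      using W unfolding U_def by blast
    then obtain F where F: "\<And>p. p \<in> I \<Longrightarrow> thin (F p)" "\<And>p. p \<in> I \<Longrightarrow> p \<in> U W \<Longrightarrow> p \<in> \<phi> (F p - W)"
      by metis
    obtain B where B: "thin B" "\<And>p. p \<in> I \<Longrightarrow> small (F p - B)"
      using bound[of F] F(1) by blast
    obtain N where N: "thin N" "\<not> small N" "N \<inter> W = {}"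
      using extend[OF W] by blast
    let ?Y = "(B \<union> N) - W"
    have "thin (B \<union> N)"
      using thin_Un B(1) N(1) by blast
    moreover have "\<not> small ?Y"
      using N small_mono[of ?Y N] by blast
    moreover have "U W \<subseteq> \<phi> ?Y"
    proof
      fix p assume p: "p \<in> U W"
      then have "p \<in> I" using U_sub by blast
      have "small ((F p - W) - ?Y)"
        by (rule small_mono[OF B(2)[OF \<open>p \<in> I\<close>]]) blast
      then show "p \<in> \<phi> ?Y"
        using mono F(2)[OF \<open>p \<in> I\<close> p] by blast
    qed
    ultimately show ?thesis
      using thin_mono[of "B \<union> N" ?Y] unfolding U_def by (intro exI[of _ ?Y]) auto
  qed
  obtain M where M: "thin M" "\<And>W. thin W \<Longrightarrow> M \<subseteq> W \<Longrightarrow> U W = U M"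
  proof -
    have "thin {}" using thin_def by auto
    \<comment> \<open>If some thin set expels \<open>p\<close> from \<open>U\<close>, then
      \<open>F p\<close> is such a set. An upper bound of all \<open>F p\<close> expels every point
      that can be expelled at all, so \<open>U\<close> is minimal there.\<close>
    then have "\<forall>p\<in>I. \<exists>W. thin W \<and> ((\<exists>W'. thin W' \<and> p \<notin> U W') \<longrightarrow> p \<notin> U W)" by blast
    then obtain F where F: "\<And>p. p \<in> I \<Longrightarrow> thin (F p)"
      "\<And>p W. p \<in> I \<Longrightarrow> thin W \<Longrightarrow> p \<notin> U W \<Longrightarrow> p \<notin> U (F p)"
      by metis
    obtain B where B: "thin B" "\<And>p. p \<in> I \<Longrightarrow> small (F p - B)"
      using bound[of F] F(1) by blast
    have "U W = U B" if W: "thin W" "B \<subseteq> W" for W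
    proof
      show "U W \<subseteq> U B"
        by (rule U_antimono) (use W in \<open>simp add: Diff_eq_empty_iff[THEN iffD2]\<close>)
      show "U B \<subseteq> U W"
      proof
        fix p assume p: "p \<in> U B"
        then have "p \<in> I" using U_sub by blast
        then have "p \<in> U (F p)"
          using U_antimono[OF B(2)] p by blast
        then show "p \<in> U W"
          using F(2)[OF \<open>p \<in> I\<close> W(1)] by blast
      qed
    qed
    then show thesis
      by (rule that[OF B(1)])
  qed
  define P where "P Y \<longleftrightarrow> thin Y \<and> Y \<inter> M = {} \<and> \<not> small Y \<and> \<phi> Y = U M" for Y
  define \<A> where "\<A> = {\<Y>. pairwise disjnt \<Y> \<and> (\<forall>Y\<in>\<Y>. P Y)}"
  \<comment> \<open>A maximal disjoint family of sets with property \<open>P\<close> cannot be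
    small: otherwise its union with \<open>M\<close> would be thin, and \<open>U_attained\<close>
    would give one more member, with value \<open>U M\<close> by the choice of
    \<open>M\<close>.\<close>
  have "\<exists>\<Y>\<in>\<A>. \<forall>\<Z>\<in>\<A>. \<Y> \<subseteq> \<Z> \<longrightarrow> \<Z> = \<Y>"
  proof (rule subset_Zorn')
    fix C assume C: "subset.chain \<A> C"
    have "pairwise disjnt (\<Union>C)"
    proof (rule pairwiseI)
      fix Y Z assume "Y \<in> \<Union>C" "Z \<in> \<Union>C" "Y \<noteq> Z"
      then obtain \<Y> \<Z> where "\<Y> \<in> C" "\<Z> \<in> C" "Y \<in> \<Y>" "Z \<in> \<Z>" by blast
      moreover from this have "\<Y> \<subseteq> \<Z> \<or> \<Z> \<subseteq> \<Y>" "\<Y> \<in> \<A>" "\<Z> \<in> \<A>"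
        using C unfolding subset_chain_def by auto
      ultimately show "disjnt Y Z"
        using \<open>Y \<noteq> Z\<close> unfolding \<A>_def by (auto dest: pairwiseD)
    qed
    moreover have "\<forall>Y\<in>\<Union>C. P Y"
      using C unfolding subset_chain_def \<A>_def by auto
    ultimately show "\<Union>C \<in> \<A>"
      unfolding \<A>_def by simp
  qed
  then obtain \<Y> where \<Y>: "\<Y> \<in> \<A>" "\<And>\<Z>. \<Z> \<in> \<A> \<Longrightarrow> \<Y> \<subseteq> \<Z> \<Longrightarrow> \<Z> = \<Y>" by blast
  have "\<not> small \<Y>"
  proof
    assume "small \<Y>"
    then have *: "thin (\<Union>W\<in>\<Y>. W)"
      by (rule thin_UN) (use \<Y>(1) in \<open>simp add: \<A>_def P_def\<close>)
    have thin: "thin (M \<union> \<Union>\<Y>)"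
      using thin_Un[OF M(1) *] by simp
    obtain Y where Y: "thin Y" "Y \<inter> (M \<union> \<Union>\<Y>) = {}" "\<not> small Y" "\<phi> Y = U (M \<union> \<Union>\<Y>)"
      using U_attained[OF thin] by (elim exE conjE) (rule that)
    then have "P Y"
      using M(2)[OF thin Un_upper1] unfolding P_def by (simp add: Int_Un_distrib)
    moreover have "\<forall>Z\<in>\<Y>. disjnt Y Z \<and> disjnt Z Y"
      using Y(2) unfolding disjnt_def by blast
    ultimately have "insert Y \<Y> \<in> \<A>"
      using \<Y>(1) unfolding \<A>_def by (simp add: pairwise_insert)
    then have "Y \<in> \<Y>"
      using \<Y>(2)[of "insert Y \<Y>"] by blast
    then have "Y = {}"
      using Y(2) by blast
    then show False
      using Y(3) by simp
  qed
  then have "|I| \<le>o |\<Y>|"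
    using I unfolding not_small_iff by (rule ordIso_ordLeq_trans[rotated])
  then have "\<exists>Y. inj_on Y I \<and> Y ` I \<subseteq> \<Y>"
    by (rule iffD2[OF card_of_ordLeq])
  then obtain Y where Y: "inj_on Y I" "Y ` I \<subseteq> \<Y>" by blast
  have "\<forall>Z\<in>\<Y>. P Z"
    using \<Y>(1) unfolding \<A>_def by simp
  then have PY: "P (Y i)" if "i \<in> I" for i
    using Y(2) that by blast
  have disj: "disjoint_family_on Y I"
    unfolding disjoint_family_on_def
  proof (intro ballI impI)
    fix i j assume "i \<in> I" "j \<in> I" "i \<noteq> j"
    then have "Y i \<in> \<Y>" "Y j \<in> \<Y>" "Y i \<noteq> Y j"
      using Y by (auto dest: inj_onD)
    then show "Y i \<inter> Y j = {}"
      using \<Y>(1) pairwiseD[of disjnt \<Y> "Y i" "Y j"] unfolding \<A>_def disjnt_def by simp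
  qed
  \<comment> \<open>Each \<open>Y i\<close> loses only a small part when cut down to
    \<open>B - M\<close>, and thinness of \<open>B\<close> bounds \<open>\<phi> (B - M)\<close> by
    \<open>U M\<close>. Hence \<open>\<phi> (Y i \<inter> ?S)\<close> lies between
    \<open>U M\<close> and \<open>\<phi> ?S\<close>, which lies in \<open>U M\<close>.\<close>
  obtain B where B: "thin B" "\<And>i. i \<in> I \<Longrightarrow> small (Y i - B)"
  proof -
    have "thin (Y i)" if "i \<in> I" for i
      using PY[OF that] unfolding P_def by simp
    then show thesis
      using bound[of Y] that by auto
  qed
  let ?S = "B - M"
  have dif: "small (Y i - (Y i \<inter> ?S))" if "i \<in> I" for i
    using PY[OF that] unfolding P_def by (intro small_mono[OF B(2)[OF that]]) blast
  have large: "\<not> small (Y i \<inter> ?S)" if "i \<in> I" for i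
  proof
    assume "small (Y i \<inter> ?S)"
    then have "small (Y i)"
      by (rule small_mono[OF small_Un[OF _ dif[OF that]]]) blast
    then show False
      using PY[OF that] unfolding P_def by blast
  qed
  have sub_S: "\<phi> ?S \<subseteq> U M"
    using B(1) unfolding U_def by blast
  have mono': "\<phi> C \<subseteq> \<phi> D" if "C \<subseteq> D" for C D
    using that by (intro mono) (simp add: Diff_eq_empty_iff[THEN iffD2])
  have eq: "\<phi> (Y i \<inter> ?S) = \<phi> ?S" if "i \<in> I" for i
  proof
    show "\<phi> (Y i \<inter> ?S) \<subseteq> \<phi> ?S"
      by (rule mono') blast
    show "\<phi> ?S \<subseteq> \<phi> (Y i \<inter> ?S)"
      using mono[OF dif[OF that]] sub_S PY[OF that] unfolding P_def by simp
  qed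
  show ?thesis
  proof (intro exI[of _ ?S] exI[of _ "\<lambda>i. Y i \<inter> ?S"] conjI ballI)
    show "?S \<subseteq> A"
      using B(1) unfolding thin_def by blast
    show "disjoint_family_on (\<lambda>i. Y i \<inter> ?S) I"
      using disj unfolding disjoint_family_on_def by blast
  qed (use large eq in auto)
qed

section \<open>Accumulation points and compactness\<close>

text \<open>For a subset of the space of size \<open>\<kappa>\<^sup>+\<close> these are its complete
  accumulation points; for a small set there are none.\<close>

definition acc :: "'a topology \<Rightarrow> 'a set \<Rightarrow> 'a set" where
  "acc X A = {x \<in> topspace X. \<forall>U. openin X U \<and> x \<in> U \<longrightarrow> \<not> small (U \<inter> A)}"

lemma acc_mono:
  assumes "small (A - B)"
  shows "acc X A \<subseteq> acc X B"
proof -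
  have "small (U \<inter> A)" if "small (U \<inter> B)" for U
    by (rule small_mono[OF small_Un[OF that assms]]) blast
  then show ?thesis
    unfolding acc_def by blast
qed

text \<open>Compactness speaks of sets of size exactly \<open>\<kappa>\<^sup>+\<close>, so it is
  applied to a subset \<open>B\<close> of that size; a neighbourhood with large trace on
  \<open>B\<close> has large trace on \<open>A\<close>.\<close>

lemma acc_nonempty:
  assumes X: "cardinal_compact (cardSuc \<kappa>) X" and A: "A \<subseteq> topspace X" "\<not> small A"
  shows "acc X A \<noteq> {}"
proof -
  have F: "|Field (cardSuc \<kappa>)| =o cardSuc \<kappa>"
    by (rule card_of_Field_ordIso[OF cardSuc_Card_order[OF card_order]])
  have "|Field (cardSuc \<kappa>)| \<le>o |A|"
    by (rule ordIso_ordLeq_trans[OF F A(2)[unfolded not_small_iff]])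
  then have "\<exists>B\<subseteq>A. |Field (cardSuc \<kappa>)| =o |B| \<and> |B| \<le>o |A|"
    by (rule iffD1[OF internalize_card_of_ordLeq2])
  then obtain B where "B \<subseteq> A" "|Field (cardSuc \<kappa>)| =o |B|" by blast
  then have B: "B \<subseteq> A" "|B| =o cardSuc \<kappa>"
    using ordIso_transitive[OF ordIso_symmetric F] by simp_all
  then obtain x where x: "complete_accumulation_point X B x"
    using X A(1) unfolding cardinal_compact_def by blast
  have "\<not> small (U \<inter> A)" if "openin X U" "x \<in> U" for U
  proof -
    have "|U \<inter> B| =o |B|"
      using x that unfolding complete_accumulation_point_def by simp
    then have "|U \<inter> B| =o cardSuc \<kappa>"
      using B(2) by (rule ordIso_transitive)
    then have "\<not> small (U \<inter> B)"
      by (rule card_eq_not_small)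
    then show ?thesis
      using small_mono[of "U \<inter> A" "U \<inter> B"] B(1) by blast
  qed
  then have "x \<in> acc X A"
    using x unfolding acc_def complete_accumulation_point_def by blast
  then show ?thesis by blast
qed

lemma acc_subset_closedin:
  assumes "closedin X C" "A \<subseteq> C"
  shows "acc X A \<subseteq> C"
proof
  fix x assume x: "x \<in> acc X A"
  show "x \<in> C"
  proof (rule ccontr)
    assume "x \<notin> C"
    moreover have "(topspace X - C) \<inter> A = {}" "openin X (topspace X - C)"
      using assms by auto
    ultimately show False
      using x \<open>x \<notin> C\<close> unfolding acc_def by force
  qed
qed

section \<open>Split sets inside open sets\<close>

lemma regular_space_nbhd:
  assumes "regular_space X" "openin X V" "x \<in> V"
  shows "\<exists>U C. openin X U \<and> closedin X C \<and> x \<in> U \<and> U \<subseteq> C \<and> C \<subseteq> V"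
proof -
  have "neighbourhood_base_of (closedin X) X"
    using assms(1) by (simp add: neighbourhood_base_of_closedin)
  then show ?thesis
    using assms(2,3) unfolding neighbourhood_base_of by simp
qed

text \<open>The points of the space double as an index set of size \<open>\<kappa>\<^sup>+\<close> for the pieces.\<close>

definition splitting :: "'a topology \<Rightarrow> 'a set \<Rightarrow> ('a \<Rightarrow> 'a set) \<Rightarrow> bool" where
  "splitting X S Y \<longleftrightarrow> S \<subseteq> topspace X \<and> disjoint_family_on Y (topspace X) \<and>
     (\<forall>i\<in>topspace X. Y i \<subseteq> S \<and> acc X (Y i) = acc X S)"

text \<open>Regularity puts a closed set \<open>C\<close> between an open \<open>U\<close> and
  \<open>V\<close>. Splitting \<open>U\<close> keeps all accumulation points in \<open>C\<close>,
  hence in \<open>V\<close>.\<close>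

lemma splitting_inside:
  assumes X: "regular_space X" "cardinal_compact (cardSuc \<kappa>) X" "|topspace X| =o cardSuc \<kappa>"
    and large: "\<And>G. openin X G \<Longrightarrow> G \<noteq> {} \<Longrightarrow> \<not> small G"
    and V: "openin X V" "V \<noteq> {}"
  shows "\<exists>S Y. splitting X S Y \<and> acc X S \<noteq> {} \<and> acc X S \<subseteq> V"
proof -
  obtain x where "x \<in> V" using V(2) by blast
  then obtain U C where U: "openin X U" "closedin X C" "x \<in> U" "U \<subseteq> C" "C \<subseteq> V"
    using regular_space_nbhd[OF X(1) V(1)] by meson
  have "|U| =o cardSuc \<kappa>"
    using card_eqI[OF large[OF U(1)] openin_subset[OF U(1)] X(3)] U(3) by blast
  moreover have "acc X B \<subseteq> topspace X" for B
    unfolding acc_def by blast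
  ultimately obtain S Y where S: "S \<subseteq> U" "disjoint_family_on Y (topspace X)"
    "\<And>i. i \<in> topspace X \<Longrightarrow> Y i \<subseteq> S" "\<And>i. i \<in> topspace X \<Longrightarrow> \<not> small (Y i)"
    "\<And>i. i \<in> topspace X \<Longrightarrow> acc X (Y i) = acc X S"
    using equal_values_family[where A=U and \<phi>="acc X", OF _ X(3) _ acc_mono] by blast
  have "S \<subseteq> topspace X"
    using S(1) openin_subset[OF U(1)] by blast
  have "x \<in> topspace X"
    using U(3) openin_subset[OF U(1)] by blast
  then have "\<not> small S"
    using S(3,4) small_mono by blast
  then have "acc X S \<noteq> {}"
    using acc_nonempty[OF X(2) \<open>S \<subseteq> topspace X\<close>] by blast
  moreover have "acc X S \<subseteq> V"
    using acc_subset_closedin[OF U(2), of S] S(1) U(4,5) by blast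
  ultimately show ?thesis
    using S \<open>S \<subseteq> topspace X\<close> unfolding splitting_def
    by (intro exI[of _ S] exI[of _ Y]) simp
qed

section \<open>Construction of the dense sets\<close>

lemma resolvable_cardSuc:
  assumes X: "regular_space X" "cardinal_compact (cardSuc \<kappa>) X" "|topspace X| =o cardSuc \<kappa>"
    and large: "\<And>G. openin X G \<Longrightarrow> G \<noteq> {} \<Longrightarrow> \<not> small G"
  shows "resolvable (cardSuc \<kappa>) X"
proof -
  let ?T = "topspace X"
  let ?R = "|?T|"
  have wo: "Well_order ?R" and FR: "Field ?R = ?T"
    by (rule card_of_Well_order, rule Field_card_of)
  define Q where "Q = {p. \<exists>S Y. splitting X S Y \<and> p \<in> acc X S}"
  have "\<forall>p\<in>Q. \<exists>S Y. splitting X S Y \<and> p \<in> acc X S"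
    unfolding Q_def by blast
  then obtain S Y where SY: "\<And>p. p \<in> Q \<Longrightarrow> splitting X (S p) (Y p) \<and> p \<in> acc X (S p)"
    by metis
  have QT: "Q \<subseteq> ?T"
    unfolding Q_def acc_def by blast
  \<comment> \<open>Each \<open>p\<close> in \<open>Q\<close> names the set \<open>S p\<close> and
    also gives its place in the well-order \<open>?R\<close>. Pieces of different sets are disjoint
    because earlier sets are removed, pieces of the same set because \<open>Y p\<close> is a
    disjoint family.\<close>
  define E where "E i = (\<Union>p\<in>Q. Y p i - (\<Union>q \<in> Q \<inter> underS ?R p. S q))" for i
  have ET: "E i \<subseteq> ?T" if "i \<in> ?T" for i
    using SY that unfolding E_def splitting_def by blast
  have disj: "E i \<inter> E j = {}" if ij: "i \<in> ?T" "j \<in> ?T" "i \<noteq> j" for i j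
  proof (rule ccontr)
    assume "E i \<inter> E j \<noteq> {}"
    then obtain x p q where *: "p \<in> Q" "x \<in> Y p i" "x \<notin> (\<Union>q \<in> Q \<inter> underS ?R p. S q)"
      "q \<in> Q" "x \<in> Y q j" "x \<notin> (\<Union>p \<in> Q \<inter> underS ?R q. S p)"
      unfolding E_def by blast
    have "x \<in> S p" "x \<in> S q"
      using * SY ij unfolding splitting_def by blast+
    moreover have "total_on ?T ?R"
      using card_of_well_order_on[of ?T] by (simp add: well_order_on_def linear_order_on_def)
    ultimately have "p = q"
      using * QT unfolding underS_def total_on_def by blast
    then show False
      using * SY ij unfolding splitting_def disjoint_family_on_def by blast
  qed
  have meets: "E i \<inter> V \<noteq> {}" if i: "i \<in> ?T" and V: "openin X V" "V \<noteq> {}" for i V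
  proof -
    let ?H = "{p \<in> Q. V \<inter> acc X (S p) \<noteq> {}}"
    \<comment> \<open>This shows that \<open>Q\<close> is dense. The set \<open>S p0\<close> chosen
      for a point \<open>p0\<close> of \<open>Q\<close> may differ from \<open>S'\<close>, but it
      still accumulates at \<open>p0\<close>.\<close>
    obtain S' Y' where "splitting X S' Y'" "acc X S' \<noteq> {}" "acc X S' \<subseteq> V"
      using splitting_inside[OF X large V] by blast
    then obtain p0 where "p0 \<in> Q" "p0 \<in> V"
      unfolding Q_def by blast
    then have "p0 \<in> ?H"
      using SY by blast
    moreover have "wf (?R - Id)"
      using wo by (simp add: well_order_on_def)
    ultimately obtain p where p: "p \<in> ?H" "\<And>q. (q, p) \<in> ?R - Id \<Longrightarrow> q \<notin> ?H"
      using wfE_min[of "?R - Id" p0 ?H] by blast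
    then obtain x where x: "x \<in> V" "x \<in> acc X (S p)" by blast
    then obtain U C where U: "openin X U" "closedin X C" "x \<in> U" "U \<subseteq> C" "C \<subseteq> V"
      using regular_space_nbhd[OF X(1) V(1)] by meson
    \<comment> \<open>A large trace on \<open>U\<close> would accumulate somewhere in
      \<open>C \<subseteq> V\<close>, so \<open>q\<close> would be a member of \<open>?H\<close>
      before the least one \<open>p\<close>.\<close>
    have "small (U \<inter> S q)" if q: "q \<in> Q \<inter> underS ?R p" for q
    proof (rule ccontr)
      assume "\<not> small (U \<inter> S q)"
      then have "acc X (U \<inter> S q) \<noteq> {}"
        using acc_nonempty[OF X(2)] openin_subset[OF U(1)] by blast
      moreover have "acc X (U \<inter> S q) \<subseteq> V"
        using acc_subset_closedin[OF U(2), of "U \<inter> S q"] U(4,5) by blast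
      moreover have "acc X (U \<inter> S q) \<subseteq> acc X (S q)"
        by (rule acc_mono) (simp add: Diff_eq_empty_iff[THEN iffD2])
      ultimately have "q \<in> ?H"
        using q by blast
      then show False
        using p(2) q unfolding underS_def by blast
    qed
    then have "small (\<Union>q \<in> Q \<inter> underS ?R p. U \<inter> S q)"
      using small_underS[OF X(3), of p] p(1) QT by (intro small_UN) (auto intro: small_mono)
    moreover have "x \<in> acc X (Y p i)"
      using SY p(1) i x unfolding splitting_def by blast
    then have "\<not> small (U \<inter> Y p i)"
      using U unfolding acc_def by blast
    ultimately have "\<not> U \<inter> Y p i \<subseteq> (\<Union>q \<in> Q \<inter> underS ?R p. U \<inter> S q)"
      using small_mono[of "\<Union>q \<in> Q \<inter> underS ?R p. U \<inter> S q" "U \<inter> Y p i"] by blast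
    then obtain y where y: "y \<in> U" "y \<in> Y p i" "y \<notin> (\<Union>q \<in> Q \<inter> underS ?R p. S q)" by blast
    then have "y \<in> E i"
      using p(1) unfolding E_def by (intro UN_I[of p]) auto
    then show ?thesis
      using y(1) U(4,5) by blast
  qed
  have ne: "?T \<noteq> {}"
    using card_eq_not_finite[OF X(3)] by auto
  \<comment> \<open>\<open>resolvable\<close> counts the dense sets themselves, so different indices
    must give different sets; disjointness and nonemptiness ensure this.\<close>
  have "inj_on E ?T"
  proof (rule inj_onI)
    fix i j assume "i \<in> ?T" "j \<in> ?T" "E i = E j"
    then show "i = j"
      using disj[of i j] meets[of i ?T] ne by auto
  qed
  then have "|E ` ?T| =o |?T|"
    using card_of_ordIso ordIso_symmetric inj_on_imp_bij_betw by blast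
  then have "|E ` ?T| =o cardSuc \<kappa>"
    using X(3) ordIso_transitive by blast
  moreover have "pairwise disjnt (E ` ?T)"
    using disj unfolding pairwise_def disjnt_def by blast
  moreover have "dense_subset X (E i)" if "i \<in> ?T" for i
    using ET[OF that] meets[OF that] unfolding dense_subset_def dense_intersects_open by blast
  ultimately show ?thesis
    unfolding resolvable_def by (intro exI[of _ "E ` ?T"]) simp
qed

end

theorem theorem4p1:
  fixes \<kappa> :: "'k rel"
  assumes "Card_order \<kappa>" and "cinfinite \<kappa>"
    and "\<forall>X \<in> (class_L \<kappa> :: 'a topology set). resolvable \<kappa> X"
  shows "\<forall>X \<in> (class_L \<kappa> :: 'a topology set). resolvable (cardSuc \<kappa>) X"
proof
  interpret infinite_cardinal \<kappa>
    using assms(1,2) by (rule infinite_cardinal.intro)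
  fix X :: "'a topology" assume "X \<in> class_L \<kappa>"
  then have X: "regular_space X" "cardinal_compact (cardSuc \<kappa>) X"
    "|topspace X| =o dispersion_character X" "dispersion_character X =o cardSuc \<kappa>"
    unfolding class_L_def by auto
  show "resolvable (cardSuc \<kappa>) X"
  proof (rule resolvable_cardSuc[OF X(1,2)])
    show "|topspace X| =o cardSuc \<kappa>"
      using X(3,4) ordIso_transitive by blast
    fix G assume G: "openin X G" "G \<noteq> {}"
    then have "topspace X \<noteq> {}"
      using openin_subset[OF G(1)] by blast
    then have "dispersion_character X \<le>o |G|"
      using G by (rule dispersion_character_minimum(2))
    then show "\<not> small G"
      unfolding not_small_iff by (rule ordIso_ordLeq_trans[OF ordIso_symmetric[OF X(4)]])
  qed
qed

end
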